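(* Let $c>0$ be a fixed constant. There is a positive absolute constant $C$ such that, for all sufficiently large $T$ and all real $k\geq c\log T/\log\log T$, $$\mathbb{E}\big[|M_f(T)|^{2k}\big]\leq e^{Ck^2}\max\big(1,(\log T)^{k^2}e^{-k^2\log k}\big).$$
   Context: Steinhaus random multiplicative function: let $(f(p))_p$, indexed by the primes, be independent random variables each uniformly distributed on the unit circle in $\mathbb{C}$, and set $f(n)=\prod_{p^{v_p}\| n}f(p)^{v_p}$ for $n\in\mathbb{N}$. Put $M_f(T)=\sum_{n\leq T}f(n)/\sqrt n$. *)

theory Defs
  imports "HOL-Probability.Probability" "HOL-Computational_Algebra.Computational_Algebra"
begin

definition uniform_circle :: "complex measure" where
  "uniform_circle = distr (uniform_measure lborel {0..<2 * pi}) borel cis"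

(* Only the values of f at primes are constrained; the others play no role. *)
locale steinhaus = prob_space M for M :: "'w measure" +
  fixes f :: "nat \<Rightarrow> 'w \<Rightarrow> complex"
  assumes indep: "indep_vars (\<lambda>_. borel) f {p. prime p}"
    and uniform: "\<And>p. prime p \<Longrightarrow> distr M borel (f p) = uniform_circle"

(* Meant for n > 0 (prime_factors 0 is empty, so the value at 0 is the junk value 1). *)
definition mult_ext :: "(nat \<Rightarrow> 'w \<Rightarrow> complex) \<Rightarrow> nat \<Rightarrow> 'w \<Rightarrow> complex" where
  "mult_ext f n \<omega> = (\<Prod>p\<in>prime_factors n. f p \<omega> ^ multiplicity p n)"

definition partial_sum :: "(nat \<Rightarrow> 'w \<Rightarrow> complex) \<Rightarrow> real \<Rightarrow> 'w \<Rightarrow> complex" where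
  "partial_sum f T \<omega> =
     (\<Sum>n | 1 \<le> n \<and> real n \<le> T. mult_ext f n \<omega> / complex_of_real (sqrt (real n)))"

end

(* Rankin's trick, applied before taking moments. For s = (1 + d)/2 the coefficients 1/sqrt n of the
   partial sum are at most T^(d/2) times those of the Euler product over primes p <= T of the
   truncated series sum_j (p^-s f(p))^j. An even moment E|F|^(2K) is monotone in nonnegative
   coefficients of F, since E[f(m) cnj(f(n))] >= 0, so E|M_f(T)|^(2K) is at most T^(dK) times a
   product of independent local moments. With x = p^(-1-d), the local moment is at most
   (1 + x)^(K^2) exp(2 K^4 x^2) for p > 4K^2 and exp(8K/sqrt p) for p <= 4K^2; the errors multiply to
   exp(O(K^2)), and the main terms to at most (1 + 1/d)^(K^2). The choice d = K / ln T gives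
   exp(34 K^2) (1 + ln T / K)^(K^2) for integers K >= 1. A real k is reached from its ceiling by
   interpolation; the loss (1 + ln T / k)^k is at most exp(k^2) because k >= c ln T / ln ln T. *)
theory Submission
  imports Defs "HOL-Real_Asymp.Real_Asymp"
begin

section \<open>Moments on the circle\<close>

lemma integral_cis_int:
  fixes m :: int
  assumes "m \<noteq> 0"
  shows "integral\<^sup>L lborel (\<lambda>t. indicator {0..2*pi} t *\<^sub>R cis (of_int m * t)) = 0"
proof -
  define F where "F t = cis (of_int m * t) / (\<i> * of_int m)" for t :: real
  have deriv: "(F has_vector_derivative cis (of_int m * t)) (at t within {0..2*pi})" for t
  proof -
    have "((\<lambda>z. exp (\<i> * of_int m * z) / (\<i> * of_int m)) has_field_derivative
            exp (\<i> * of_int m * of_real t)) (at (of_real t))"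
      using assms by (auto intro!: derivative_eq_intros)
    then have "((\<lambda>t. exp (\<i> * of_int m * of_real t) / (\<i> * of_int m)) has_vector_derivative
            exp (\<i> * of_int m * of_real t)) (at t within {0..2*pi})"
      by (rule has_vector_derivative_real_field)
    then show ?thesis
      unfolding F_def cis_conv_exp by (simp add: mult.assoc)
  qed
  have "integral\<^sup>L lborel (\<lambda>t. indicator {0..2*pi} t *\<^sub>R cis (of_int m * t)) = F (2*pi) - F 0"
    by (intro integral_FTC_atLeastAtMost deriv) (auto intro!: continuous_intros)
  also have "\<dots> = 0"
    using assms cis_multiple_2pi[of "of_int m"] by (simp add: F_def mult.commute mult.left_commute)
  finally show ?thesis .
qed

lemma uniform_circle_density:
  "uniform_measure lborel {0..<2*pi} = density lborel (\<lambda>t. ennreal (indicator {0..<2*pi} t / (2*pi)))"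
proof -
  have "indicator {0..<2*pi} t / ennreal (2*pi) = ennreal (indicator {0..<2*pi} t / (2*pi))" for t
    by (subst ennreal_indicator[symmetric], subst divide_ennreal) auto
  then show ?thesis unfolding uniform_measure_def by simp
qed

lemma measurable_cis [measurable]: "cis \<in> borel_measurable borel"
  by (intro borel_measurable_continuous_onI continuous_intros)

lemma prob_space_uniform_circle: "prob_space uniform_circle"
  unfolding uniform_circle_def
  by (intro prob_space.prob_space_distr prob_space_uniform_measure)
     simp_all

lemma sets_uniform_circle [simp, measurable_cong]: "sets uniform_circle = sets borel"
  and space_uniform_circle [simp]: "space uniform_circle = UNIV"
  by (auto simp: uniform_circle_def)

lemma AE_uniform_circle_norm: "AE z in uniform_circle. norm z = 1"
  unfolding uniform_circle_def
  by (subst AE_distr_iff) simp_all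

lemma integral_uniform_circle:
  fixes g :: "complex \<Rightarrow> complex"
  assumes [measurable]: "g \<in> borel_measurable borel"
  shows "integral\<^sup>L uniform_circle g = integral\<^sup>L lborel (\<lambda>t. indicator {0..2*pi} t *\<^sub>R g (cis t)) / (2*pi)"
proof -
  have "integral\<^sup>L uniform_circle g = integral\<^sup>L lborel (\<lambda>t. (indicator {0..<2*pi} t / (2*pi)) *\<^sub>R g (cis t))"
    unfolding uniform_circle_def
    by (subst integral_distr) (simp_all add: uniform_circle_density integral_density)
  \<comment> \<open>The half-open interval of the uniform measure becomes closed at the cost of the
    null set {2 pi}; the fundamental theorem of calculus is applied on a closed interval.\<close>
  also have "\<dots> = integral\<^sup>L lborel (\<lambda>t. (indicator {0..2*pi} t / (2*pi)) *\<^sub>R g (cis t))"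
  proof (intro integral_cong_AE)
    show "AE t in lborel. (indicator {0..<2*pi} t / (2*pi)) *\<^sub>R g (cis t) = (indicator {0..2*pi} t / (2*pi)) *\<^sub>R g (cis t)"
      using AE_lborel_singleton[of "2*pi"] by eventually_elim (auto simp: indicator_def)
  qed simp_all
  also have "\<dots> = integral\<^sup>L lborel (\<lambda>t. (1/(2*pi)) *\<^sub>R (indicator {0..2*pi} t *\<^sub>R g (cis t)))"
    by simp
  also have "\<dots> = (1/(2*pi)) *\<^sub>R integral\<^sup>L lborel (\<lambda>t. indicator {0..2*pi} t *\<^sub>R g (cis t))"
    by (rule integral_scaleR_right) 
  finally show ?thesis by (simp add: scaleR_conv_of_real field_simps)
qed

text \<open>On the circle the integrand is the character \<open>cis ((a - b) * t)\<close>, whose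
  integral over a full period vanishes unless a = b.\<close>

lemma circle_moment:
  "integral\<^sup>L uniform_circle (\<lambda>z. z ^ a * cnj z ^ b) = (if a = b then 1 else 0)"
proof -
  have "cis t ^ a * cnj (cis t) ^ b = cis (of_int (int a - int b) * t)" for t
    by (simp add: Complex.DeMoivre cis_cnj cis_mult algebra_simps)
  then have "integral\<^sup>L uniform_circle (\<lambda>z. z ^ a * cnj z ^ b) =
     integral\<^sup>L lborel (\<lambda>t. indicator {0..2*pi} t *\<^sub>R cis (of_int (int a - int b) * t)) / (2*pi)"
    by (subst integral_uniform_circle) 
       (auto intro!: borel_measurable_continuous_onI continuous_intros)
  also have "\<dots> = (if a = b then 1 else 0)"
    using integral_cis_int[of "int a - int b"] 
    by (auto simp: scaleR_conv_of_real)
  finally show ?thesis .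
qed

lemma integrable_uniform_circle:
  fixes g :: "complex \<Rightarrow> 'b :: {banach, second_countable_topology}"
  assumes "g \<in> borel_measurable borel" "\<And>z. norm z = 1 \<Longrightarrow> norm (g z) \<le> B"
  shows "integrable uniform_circle g"
proof -
  interpret prob_space uniform_circle by (rule prob_space_uniform_circle)
  show ?thesis
    using assms AE_uniform_circle_norm by (intro integrable_const_bound[where B = B]) auto
qed

section \<open>Local moments of truncated geometric series\<close>

lemma circle_parseval:
  fixes c :: "nat \<Rightarrow> real"
  shows "integral\<^sup>L uniform_circle (\<lambda>z. (norm (\<Sum>j\<le>N. of_real (c j) * z ^ j))\<^sup>2) = (\<Sum>j\<le>N. (c j)\<^sup>2)"
proof -
  have eq: "complex_of_real ((norm (\<Sum>j\<le>N. of_real (c j) * z ^ j))\<^sup>2) =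
      (\<Sum>i\<le>N. \<Sum>j\<le>N. of_real (c i * c j) * (z ^ i * cnj z ^ j))" for z :: complex
    by (simp add: complex_norm_square sum_product mult_ac flip: of_real_power)
  have int: "integrable uniform_circle (\<lambda>z. of_real (c i * c j) * (z ^ i * cnj z ^ j))" for i j
    by (intro integrable_uniform_circle[where B = "\<bar>c i * c j\<bar>"])
       (auto simp: norm_mult norm_power abs_mult intro!: borel_measurable_continuous_onI continuous_intros)
  have "complex_of_real (integral\<^sup>L uniform_circle (\<lambda>z. (norm (\<Sum>j\<le>N. of_real (c j) * z ^ j))\<^sup>2)) =
     integral\<^sup>L uniform_circle (\<lambda>z. \<Sum>i\<le>N. \<Sum>j\<le>N. of_real (c i * c j) * (z ^ i * cnj z ^ j))"
    unfolding eq[symmetric] by (rule integral_complex_of_real[symmetric])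
  also have "\<dots> = (\<Sum>i\<le>N. \<Sum>j\<le>N. of_real (c i * c j) * (if i = j then 1 else 0))"
    using int by (simp add: Bochner_Integration.integral_sum Bochner_Integration.integrable_sum 
        integral_mult_right_zero circle_moment del: of_real_mult)
  also have "\<dots> = of_real (\<Sum>j\<le>N. (c j)\<^sup>2)"
    by (simp add: power2_eq_square if_distrib sum.delta cong: if_cong)
  finally show ?thesis using of_real_eq_iff by blast
qed

text \<open>Each binomial coefficient in the expansion of (x + 1)^j is at least 1.\<close>

lemma sum_power_le_Suc_power:
  fixes x :: real
  assumes "x \<ge> 0"
  shows "(\<Sum>i\<le>j. x ^ i) \<le> (x + 1) ^ j"
proof -
  have "(\<Sum>i\<le>j. x ^ i) \<le> (\<Sum>i\<le>j. of_nat (j choose i) * x ^ i)"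
    using assms by (intro sum_mono) (simp add: Suc_leI zero_less_binomial mult_right_le_one_le mult_le_cancel_right1)
  also have "\<dots> = (x + 1) ^ j"
    by (simp add: binomial_ring)
  finally show ?thesis .
qed

text \<open>The extremal case is the geometric series, where the coefficient is r^j times the number
  of multisets of size j from K elements, at most K^j. The induction on K replaces this count:
  convolving K^i with 1 gives at most (K + 1)^j.\<close>

lemma coeff_power_le:
  fixes h :: "real poly"
  assumes h: "\<And>j. 0 \<le> coeff h j" "\<And>j. coeff h j \<le> r ^ j" and r: "r \<ge> 0"
  shows "0 \<le> coeff (h ^ K) j \<and> coeff (h ^ K) j \<le> (real K * r) ^ j"
proof (induction K arbitrary: j)
  case 0
  show ?case by (auto simp: coeff_1 power_0_left)
next
  case (Suc K)
  have "coeff (h ^ Suc K) j = (\<Sum>i\<le>j. coeff (h ^ K) i * coeff h (j - i))"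
    by (simp only: power_Suc2 coeff_mult)
  moreover have "(\<Sum>i\<le>j. coeff (h ^ K) i * coeff h (j - i)) \<le> (\<Sum>i\<le>j. (real K * r) ^ i * r ^ (j - i))"
    using Suc h r by (intro sum_mono mult_mono) auto
  moreover have "\<dots> = r ^ j * (\<Sum>i\<le>j. real K ^ i)"
    unfolding sum_distrib_left by (intro sum.cong refl) (simp add: power_mult_distrib mult_ac flip: power_add)
  moreover have "\<dots> \<le> r ^ j * (real K + 1) ^ j"
    using r by (intro mult_left_mono sum_power_le_Suc_power) auto
  moreover have "\<dots> = (real (Suc K) * r) ^ j"
    by (simp add: power_mult_distrib mult.commute add.commute)
  moreover have "0 \<le> (\<Sum>i\<le>j. coeff (h ^ K) i * coeff h (j - i))"
    using Suc h by (intro sum_nonneg) auto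
  ultimately show ?case by linarith
qed

lemma sum_power_le_quadratic:
  fixes y :: real
  assumes "0 \<le> y" "y \<le> 1 / 2"
  shows "(\<Sum>j\<le>N. y ^ j) \<le> 1 + y + 2 * y\<^sup>2"
proof -
  \<comment> \<open>Lengthening the sum to N + 3 terms lets the terms 1 and y be split off for every
    N, leaving y^2 times a geometric sum bounded by 2.\<close>
  have "(\<Sum>j\<le>N. y ^ j) \<le> (\<Sum>j<Suc (Suc (Suc N)). y ^ j)"
    using assms by (intro sum_mono2) auto
  also have "\<dots> = 1 + y + y\<^sup>2 * (\<Sum>j<Suc N. y ^ j)"
    by (simp add: sum.lessThan_Suc_shift sum_distrib_left power2_eq_square algebra_simps del: sum.lessThan_Suc)
  also have "(\<Sum>j<Suc N. y ^ j) \<le> 2"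
  proof -
    have "(\<Sum>j<Suc N. y ^ j) * (1 - y) = 1 - y ^ Suc N"
      using one_diff_power_eq[of y "Suc N"] by (simp add: mult.commute)
    also have "\<dots> \<le> 1" using assms by simp
    also have "1 \<le> 2 * (1 - y)" using assms by simp
    finally show ?thesis
      by (rule mult_right_le_imp_le) (use assms in simp)
  qed
  finally show ?thesis using assms by (simp add: mult_left_mono)
qed

lemma map_poly_of_real_mult:
  "map_poly complex_of_real (p * q) = map_poly of_real p * map_poly of_real q"
  by (rule poly_eqI) (simp add: coeff_map_poly coeff_mult)

text \<open>By Parseval the moment is the sum of the squared coefficients of the K-th power, at most
  the sum of y^j with y = K^2 r^2, hence at most 1 + y + 2 y^2. Bernoulli's inequality turns 1 + K^2
  r^2 into (1 + r^2)^(K^2), a shape whose product over primes can be compared with a zeta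
  sum.\<close>

lemma circle_geometric_moment_le:
  fixes r :: real
  assumes r: "0 \<le> r" and Kr: "(real K * r)\<^sup>2 \<le> 1 / 2"
  shows "integral\<^sup>L uniform_circle (\<lambda>z. norm (\<Sum>j\<le>J. (of_real r * z) ^ j) ^ (2 * K))
     \<le> (1 + r\<^sup>2) ^ K\<^sup>2 * exp (2 * real K ^ 4 * (r\<^sup>2)\<^sup>2)"
proof -
  define h where "h = (\<Sum>j\<le>J. monom (r ^ j) j)"
  define N where "N = degree (h ^ K)"
  have coeff_h: "coeff h i = (if i \<le> J then r ^ i else 0)" for i
    by (simp add: h_def coeff_sum)
  have "map_poly complex_of_real h = (\<Sum>j\<le>J. monom (of_real r ^ j) j)"
    by (rule poly_eqI) (simp add: coeff_map_poly coeff_h coeff_sum)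
  then have poly_h: "poly (map_poly complex_of_real h) z = (\<Sum>j\<le>J. (of_real r * z) ^ j)" for z
    by (simp add: poly_sum poly_monom power_mult_distrib)
  have "norm (\<Sum>j\<le>J. (of_real r * z) ^ j) ^ (2 * K) = (norm (\<Sum>j\<le>N. of_real (coeff (h ^ K) j) * z ^ j))\<^sup>2" for z :: complex
  proof -
    have "(\<Sum>j\<le>N. of_real (coeff (h ^ K) j) * z ^ j) = poly (map_poly complex_of_real (h ^ K)) z"
      by (simp add: N_def poly_altdef coeff_map_poly degree_map_poly)
    also have "\<dots> = poly (map_poly complex_of_real h) z ^ K"
      by (induction K) (simp_all add: map_poly_of_real_mult)
    finally show ?thesis
      by (simp add: poly_h norm_power power_mult mult.commute)
  qed
  then have "integral\<^sup>L uniform_circle (\<lambda>z. norm (\<Sum>j\<le>J. (of_real r * z) ^ j) ^ (2 * K))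
      = (\<Sum>j\<le>N. (coeff (h ^ K) j)\<^sup>2)"
    by (simp add: circle_parseval)
  also have "\<dots> \<le> (\<Sum>j\<le>N. ((real K * r)\<^sup>2) ^ j)"
  proof (intro sum_mono)
    fix j
    have "0 \<le> coeff (h ^ K) j \<and> coeff (h ^ K) j \<le> (real K * r) ^ j"
      using r by (intro coeff_power_le) (auto simp: coeff_h)
    then have "(coeff (h ^ K) j)\<^sup>2 \<le> ((real K * r) ^ j)\<^sup>2"
      by (intro power_mono) auto
    then show "(coeff (h ^ K) j)\<^sup>2 \<le> ((real K * r)\<^sup>2) ^ j"
      by (simp only: power_mult[symmetric] mult.commute)
  qed
  also have "\<dots> \<le> 1 + (real K * r)\<^sup>2 + 2 * ((real K * r)\<^sup>2)\<^sup>2"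
    using Kr by (intro sum_power_le_quadratic) auto
  \<comment> \<open>Separating the quadratic term into its own factor only adds the product of the
    two corrections, 2 K^6 r^6.\<close>
  also have "\<dots> \<le> (1 + real (K\<^sup>2) * r\<^sup>2) * (1 + 2 * real K ^ 4 * (r\<^sup>2)\<^sup>2)"
  proof -
    have "(1 + real (K\<^sup>2) * r\<^sup>2) * (1 + 2 * real K ^ 4 * (r\<^sup>2)\<^sup>2) - (1 + (real K * r)\<^sup>2 + 2 * ((real K * r)\<^sup>2)\<^sup>2)
        = 2 * real K ^ 6 * r ^ 6"
      by (simp add: algebra_simps power_mult_distrib flip: power_mult power_add)
    moreover have "2 * real K ^ 6 * r ^ 6 \<ge> 0" using r by simp
    ultimately show ?thesis by linarith
  qed
  also have "\<dots> \<le> (1 + r\<^sup>2) ^ K\<^sup>2 * exp (2 * real K ^ 4 * (r\<^sup>2)\<^sup>2)"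
    by (intro mult_mono Bernoulli_inequality exp_ge_add_one_self) (auto intro: order_trans[of _ 0])
  finally show ?thesis .
qed

text \<open>The hypothesis forces r <= 3/4, and then (1 - r)(1 + 4r) = 1 + r(3 - 4r) >= 1. The bound
  r^2 <= 1/2 is what the smallest prime provides.\<close>

lemma inverse_one_minus_le_exp:
  fixes r :: real
  assumes "0 \<le> r" "r\<^sup>2 \<le> 1 / 2"
  shows "1 / (1 - r) \<le> exp (4 * r)"
proof -
  have "r \<le> 3 / 4"
    using assms power2_le_imp_le[of r "3/4"] by (simp add: power2_eq_square)
  then have "1 \<le> (1 - r) * (1 + 4 * r)"
    using assms by (simp add: algebra_simps power2_eq_square) (use mult_left_mono[of r "3/4" r] in simp)
  also have "\<dots> \<le> (1 - r) * exp (4 * r)"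
    using \<open>r \<le> 3/4\<close> by (intro mult_left_mono exp_ge_add_one_self) auto
  finally show ?thesis
    using \<open>r \<le> 3/4\<close> by (simp add: field_simps)
qed

lemma norm_geometric_le:
  fixes r :: real and z :: complex
  assumes r: "0 \<le> r" "r < 1" and z: "norm z = 1"
  shows "norm (\<Sum>j\<le>J. (of_real r * z) ^ j) \<le> 1 / (1 - r)"
proof -
  have "norm (\<Sum>j\<le>J. (of_real r * z) ^ j) \<le> (\<Sum>j<Suc J. r ^ j)"
    unfolding lessThan_Suc_atMost
    by (rule sum_norm_le) (use r z in \<open>simp add: norm_mult norm_power\<close>)
  also have "\<dots> = (1 - r ^ Suc J) / (1 - r)"
    using one_diff_power_eq[of r "Suc J"] r by (simp add: field_simps)
  also have "\<dots> \<le> 1 / (1 - r)"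
    using r by (intro divide_right_mono) auto
  finally show ?thesis .
qed

lemma circle_geometric_moment_le_trivial:
  fixes r :: real
  assumes r: "0 \<le> r" "r\<^sup>2 \<le> 1 / 2"
  shows "integral\<^sup>L uniform_circle (\<lambda>z. norm (\<Sum>j\<le>J. (of_real r * z) ^ j) ^ (2 * K)) \<le> exp (8 * real K * r)"
proof -
  interpret prob_space uniform_circle by (rule prob_space_uniform_circle)
  have "r < 1"
    using r power2_less_imp_less[of r 1] by simp
  have bound: "norm (\<Sum>j\<le>J. (of_real r * z) ^ j) ^ (2 * K) \<le> exp (8 * real K * r)" if "norm z = 1" for z :: complex
  proof -
    have "norm (\<Sum>j\<le>J. (of_real r * z) ^ j) \<le> exp (4 * r)"
      using norm_geometric_le[OF r(1) \<open>r < 1\<close> that] inverse_one_minus_le_exp[OF r] by (rule order_trans)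
    then have "norm (\<Sum>j\<le>J. (of_real r * z) ^ j) ^ (2 * K) \<le> exp (4 * r) ^ (2 * K)"
      by (intro power_mono) auto
    also have "\<dots> = exp (8 * real K * r)"
      by (simp flip: exp_of_nat_mult)
    finally show ?thesis .
  qed
  have "integral\<^sup>L uniform_circle (\<lambda>z. norm (\<Sum>j\<le>J. (of_real r * z) ^ j) ^ (2 * K))
      \<le> integral\<^sup>L uniform_circle (\<lambda>_. exp (8 * real K * r))"
  proof (rule integral_mono_AE)
    show "integrable uniform_circle (\<lambda>z. norm (\<Sum>j\<le>J. (of_real r * z) ^ j) ^ (2 * K))"
      using bound by (intro integrable_uniform_circle[where B = "exp (8 * real K * r)"])
         (auto intro!: borel_measurable_continuous_onI continuous_intros)
    show "AE z in uniform_circle. norm (\<Sum>j\<le>J. (of_real r * z) ^ j) ^ (2 * K) \<le> exp (8 * real K * r)"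
      using AE_uniform_circle_norm by eventually_elim (rule bound)
  qed simp
  then show ?thesis by (simp add: prob_space del: space_uniform_circle)
qed

text \<open>The cut at 4K^2 ensures K^2 r^2 <= K^2 / p < 1/4 for the larger primes, within the reach
  of the Parseval estimate.\<close>

lemma circle_geometric_moment_le_euler_factor:
  fixes d :: real
  assumes p: "prime p" and d: "d \<ge> 0"
  shows "integral\<^sup>L uniform_circle (\<lambda>z. norm (\<Sum>j\<le>J. (of_real (real p powr (- ((1 + d) / 2))) * z) ^ j) ^ (2 * K))
    \<le> (1 + real p powr (- 1 - d)) ^ K\<^sup>2 * 
       exp (if p \<le> 4 * K\<^sup>2 then 8 * real K * (1 / sqrt p) else 2 * real K ^ 4 * (1 / (real p)\<^sup>2))"
proof -
  define r where "r = real p powr (- ((1 + d) / 2))"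
  have p2: "p \<ge> 2" using p prime_ge_2_nat by blast
  have r0: "r \<ge> 0" by (simp add: r_def)
  have r_sq: "r\<^sup>2 = real p powr (- 1 - d)"
    using p2 by (simp add: r_def powr_power) (rule arg_cong[where f = "\<lambda>x. real p powr x"], simp add: field_simps)
  have "r \<le> real p powr (- (1 / 2))"
    unfolding r_def using p2 d by (intro powr_mono) auto
  then have r_le: "r \<le> 1 / sqrt p"
    by (simp add: powr_minus_divide powr_half_sqrt)
  have "r\<^sup>2 \<le> real p powr (- 1)"
    unfolding r_sq using p2 d by (intro powr_mono) auto
  then have r_sq_le: "r\<^sup>2 \<le> 1 / p"
    using p2 by (simp add: powr_minus_divide)
  show ?thesis
  proof (cases "p \<le> 4 * K\<^sup>2")
    case True
    have "1 / real p \<le> 1 / 2" using p2 by (simp add: field_simps)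
    then have "integral\<^sup>L uniform_circle (\<lambda>z. norm (\<Sum>j\<le>J. (of_real r * z) ^ j) ^ (2 * K)) \<le> exp (8 * real K * r)"
      using circle_geometric_moment_le_trivial[OF r0, of J K] r_sq_le by simp
    also have "\<dots> \<le> exp (8 * real K * (1 / sqrt p))"
      using r_le unfolding exp_le_cancel_iff by (intro mult_left_mono) auto
    \<comment> \<open>A factor at least 1 is inserted so that small and large primes share one main
      term and the product of main terms runs over all primes alike.\<close>
    also have "\<dots> \<le> (1 + r\<^sup>2) ^ K\<^sup>2 * exp (8 * real K * (1 / sqrt p))"
      using one_le_power[of "1 + r\<^sup>2" "K\<^sup>2"] by simp
    finally show ?thesis using True by (simp add: r_def[symmetric] r_sq[symmetric])
  next
    case False
    then have "real (4 * K\<^sup>2) < real p" by linarith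
    then have "real K ^ 2 * (1 / p) \<le> 1 / 2"
      using p2 by (simp add: field_simps)
    moreover have "real K ^ 2 * r\<^sup>2 \<le> real K ^ 2 * (1 / p)"
      using r_sq_le by (rule mult_left_mono) simp
    ultimately have "(real K * r)\<^sup>2 \<le> 1 / 2"
      unfolding power_mult_distrib by linarith
    then have "integral\<^sup>L uniform_circle (\<lambda>z. norm (\<Sum>j\<le>J. (of_real r * z) ^ j) ^ (2 * K))
       \<le> (1 + r\<^sup>2) ^ K\<^sup>2 * exp (2 * real K ^ 4 * (r\<^sup>2)\<^sup>2)"
      by (rule circle_geometric_moment_le[OF r0])
    also have "\<dots> \<le> (1 + r\<^sup>2) ^ K\<^sup>2 * exp (2 * real K ^ 4 * (1 / (real p)\<^sup>2))"
    proof (intro mult_left_mono exp_le_cancel_iff[THEN iffD2])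
      show "(r\<^sup>2)\<^sup>2 \<le> 1 / (real p)\<^sup>2"
        using power_mono[OF r_sq_le, of 2] by (simp add: power_divide)
    qed auto
    finally show ?thesis using False by (simp add: r_def[symmetric] r_sq[symmetric])
  qed
qed

section \<open>Elementary sums over integers and primes\<close>

text \<open>Telescoping: with u, v the square roots of N and N + 1, the inequality (v - u)^2 >= 0
  and v^2 = u^2 + 1 give 1/v <= 2v - 2u.\<close>

lemma sum_inverse_sqrt_le:
  "(\<Sum>n\<in>{1..N}. 1 / sqrt (real n)) \<le> 2 * sqrt (real N)"
proof (induction N)
  case (Suc N)
  define u v where "u = sqrt (real N)" and "v = sqrt (real (Suc N))"
  have uv: "u \<ge> 0" "v > 0" "v\<^sup>2 = u\<^sup>2 + 1" 
    by (simp_all add: u_def v_def)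
  have "2 * u * v \<le> 2 * v\<^sup>2 - 1"
    using uv zero_le_power2[of "v - u"] by (simp add: power2_diff mult_ac)
  then have "1 / v \<le> 2 * v - 2 * u"
    using uv by (simp add: field_simps power2_eq_square)
  with Suc show ?case by (simp add: u_def v_def)
qed simp

lemma sum_inverse_squares_tail_le:
  assumes "m \<ge> 1"
  shows "(\<Sum>n\<in>{m<..N}. 1 / (real n)\<^sup>2) \<le> 1 / real m"
proof -
  have "(\<Sum>n\<in>{m<..N}. 1 / (real n)\<^sup>2) \<le> 1 / real m - 1 / real N" if "m \<le> N"
    using that
  proof (induction N rule: dec_induct)
    case (step N)
    have "{m<..Suc N} = insert (Suc N) {m<..N}" using step by auto
    moreover have "1 / (real (Suc N))\<^sup>2 \<le> 1 / real N - 1 / real (Suc N)"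
    proof -
      have "1 / (real (Suc N))\<^sup>2 \<le> 1 / (real N * real (Suc N))"
        using step assms unfolding power2_eq_square by (intro divide_left_mono mult_right_mono) auto
      also have "\<dots> = 1 / real N - 1 / real (Suc N)"
        using step assms by (simp add: field_simps)
      finally show ?thesis .
    qed
    ultimately show ?case using step.IH by simp
  qed simp
  moreover have "{m<..N} = {}" if "\<not> m \<le> N" using that by auto
  ultimately show ?thesis
    by (cases "m \<le> N") (auto intro: order_trans)
qed

lemma sum_powr_le:
  fixes d :: real
  assumes "d > 0"
  shows "(\<Sum>n\<in>{1..N}. real n powr (- 1 - d)) \<le> 1 + 1 / d"
proof -
  have exponent: "- 1 - d = - d - 1" by simp
  \<comment> \<open>Subtracting N^(-d) / d makes the claim inductive: by the mean value theorem the
    drop of n^(-d) / d from N to N + 1 is at least the new term.\<close>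
  have "(\<Sum>n\<in>{1..N}. real n powr (- 1 - d)) \<le> 1 + 1 / d - real N powr (- d) / d" if "N \<ge> 1"
    using that
  proof (induction N rule: dec_induct)
    case (step N)
    have "\<exists>z. real N < z \<and> z < real (Suc N) \<and>
       (real (Suc N)) powr (- d) - real N powr (- d) = (real (Suc N) - real N) * (- d * z powr (- d - 1))"
      using step by (intro MVT2) (auto intro!: derivative_eq_intros)
    then obtain z where z: "real N < z" "z < real (Suc N)"
      "(real (Suc N)) powr (- d) - real N powr (- d) = - d * z powr (- d - 1)" by auto
    have "real (Suc N) powr (- d - 1) \<le> z powr (- d - 1)"
      using z assms step by (intro powr_mono2') auto
    then have "d * real (Suc N) powr (- d - 1) \<le> d * z powr (- d - 1)"
      using assms by simp
    then have "d * real (Suc N) powr (- d - 1) \<le> real N powr (- d) - real (Suc N) powr (- d)"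
      using z(3) by linarith
    then have "real (Suc N) powr (- 1 - d) \<le> (real N powr (- d) - real (Suc N) powr (- d)) / d"
      unfolding exponent using assms by (simp add: pos_le_divide_eq mult.commute)
    then show ?case using step.IH by (simp add: diff_divide_distrib)
  qed simp
  moreover have "real N powr (- d) / d \<ge> 0" using assms by simp
  ultimately have "N \<ge> 1 \<Longrightarrow> ?thesis"
    by linarith
  moreover have "\<not> N \<ge> 1 \<Longrightarrow> ?thesis"
    using assms by simp
  ultimately show ?thesis by blast
qed

text \<open>Expanding the product gives a sum over squarefree integers, one for each subset of P.
  These are distinct, so the sum is part of the series for zeta(1 + d).\<close>

lemma prod_primes_powr_le:
  fixes d :: real
  assumes d: "d > 0" and P: "finite P" "P \<subseteq> {p. prime p}"
  shows "(\<Prod>p\<in>P. 1 + real p powr (- 1 - d)) \<le> 1 + 1 / d"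
proof -
  have inj: "inj_on (\<lambda>X. \<Prod>p\<in>X. p) (Pow P)"
  proof (rule inj_onI)
    fix X Y assume XY: "X \<in> Pow P" "Y \<in> Pow P" "(\<Prod>p\<in>X. p) = (\<Prod>p\<in>Y. p)"
    \<comment> \<open>A set of primes is recovered from its product as the set of prime divisors;
      this is the injectivity.\<close>
    have eq: "X = {p. prime p \<and> p dvd \<Prod>X}" if "X \<in> Pow P" for X
    proof -
      have "finite X" "\<And>p. p \<in> X \<Longrightarrow> prime p" using that P finite_subset by auto
      then have "p \<in> X \<longleftrightarrow> prime p \<and> p dvd \<Prod>X" for p
        by (metis dvd_refl prime_dvd_prod_iff primes_dvd_imp_eq)
      then show ?thesis by blast
    qed
    show "X = Y" using eq[OF XY(1)] eq[OF XY(2)] XY(3) by simp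
  qed
  define N where "N = \<Prod>P"
  have sub: "(\<lambda>X. \<Prod>p\<in>X. p) ` Pow P \<subseteq> {1..N}"
  proof
    fix n assume "n \<in> (\<lambda>X. \<Prod>p\<in>X. p) ` Pow P"
    then obtain X where X: "X \<subseteq> P" "n = \<Prod>X" by auto
    have pos: "\<And>p. p \<in> P \<Longrightarrow> p > 0" using P prime_gt_0_nat by auto
    have "n dvd N" unfolding N_def X(2) using X P by (intro prod_dvd_prod_subset)
    moreover have "n > 0" "N > 0" unfolding N_def X(2) using X pos by (auto intro!: prod_pos)
    ultimately show "n \<in> {1..N}" using dvd_imp_le by auto
  qed
  have "(\<Prod>p\<in>P. 1 + real p powr (- 1 - d)) = (\<Sum>X\<in>Pow P. \<Prod>p\<in>X. real p powr (- 1 - d))"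
    using prod_add[OF P(1), of "\<lambda>p. real p powr (- 1 - d)" "\<lambda>_. 1"] by (simp add: add.commute)
  also have "\<dots> = (\<Sum>X\<in>Pow P. real (\<Prod>p\<in>X. p) powr (- 1 - d))"
    by (simp add: prod_powr_distrib)
  also have "\<dots> = (\<Sum>n\<in>(\<lambda>X. \<Prod>p\<in>X. p) ` Pow P. real n powr (- 1 - d))"
    by (subst sum.reindex[OF inj]) simp
  also have "\<dots> \<le> (\<Sum>n\<in>{1..N}. real n powr (- 1 - d))"
    by (intro sum_mono2 sub) auto
  also have "\<dots> \<le> 1 + 1 / d" by (rule sum_powr_le[OF d])
  finally show ?thesis .
qed

text \<open>Summing over all integers instead of primes already has order K^2: the small range gives
  8K * 2 sqrt(4K^2) = 32 K^2, the tail 2K^4 / (4K^2) = K^2 / 2. Inserting 0 under \<open>Max\<close>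
  covers empty P.\<close>

lemma sum_error_exponents_le:
  fixes K :: nat
  assumes K: "K \<ge> 1" and P: "finite P" "\<And>p. p \<in> P \<Longrightarrow> p \<ge> 1"
  shows "(\<Sum>p\<in>P. if p \<le> 4 * K\<^sup>2 then 8 * real K * (1 / sqrt (real p)) else 2 * real K ^ 4 * (1 / (real p)\<^sup>2)) \<le> 33 * (real K)\<^sup>2"
proof -
  let ?A = "{1..4 * K\<^sup>2}" and ?B = "{4 * K\<^sup>2<..Max (insert 0 P)}"
  have "(\<Sum>p\<in>P. if p \<le> 4 * K\<^sup>2 then 8 * real K * (1 / sqrt (real p)) else 2 * real K ^ 4 * (1 / (real p)\<^sup>2))
      \<le> (\<Sum>p\<in>?A \<union> ?B. if p \<le> 4 * K\<^sup>2 then 8 * real K * (1 / sqrt (real p)) else 2 * real K ^ 4 * (1 / (real p)\<^sup>2))"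
    using P by (intro sum_mono2) (auto simp: not_le Suc_le_eq)
  also have "\<dots> = 8 * real K * (\<Sum>p\<in>?A. 1 / sqrt (real p)) + 2 * real K ^ 4 * (\<Sum>p\<in>?B. 1 / (real p)\<^sup>2)"
    unfolding sum_distrib_left by (subst sum.union_disjoint) (auto intro!: arg_cong2[where f = "(+)"] sum.cong)
  also have "\<dots> \<le> 8 * real K * (2 * sqrt (real (4 * K\<^sup>2))) + 2 * real K ^ 4 * (1 / real (4 * K\<^sup>2))"
    using K by (intro add_mono mult_left_mono sum_inverse_sqrt_le sum_inverse_squares_tail_le) auto
  also have "\<dots> = 32 * (real K)\<^sup>2 + (real K)\<^sup>2 / 2"
    using K by (simp add: real_sqrt_mult field_simps power2_eq_square power4_eq_xxxx)
  also have "\<dots> \<le> 33 * (real K)\<^sup>2"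
    by simp
  finally show ?thesis .
qed

text \<open>This confines the exponents of every n <= T to the finite range up to the integer part
  of T.\<close>

lemma multiplicity_le_self:
  fixes n p :: nat
  assumes "prime p" "n > 0"
  shows "multiplicity p n \<le> n"
proof -
  have "multiplicity p n < 2 ^ multiplicity p n" by simp
  also have "2 ^ multiplicity p n \<le> p ^ multiplicity p n"
    using assms prime_ge_2_nat by (intro power_mono) auto
  also have "\<dots> \<le> n"
    using assms by (intro dvd_imp_le multiplicity_dvd)
  finally show ?thesis by simp
qed

lemma powr_power_swap:
  fixes x y :: real
  assumes "x \<ge> 0"
  shows "(x ^ n) powr y = (x powr y) ^ n"
  using assms by (induction n) (simp_all add: powr_mult)

text \<open>For n <= T, write n^(-1/2) = n^(d/2) n^(-(1+d)/2) and bound n by T in the first factor.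
  For n > T the left side is 0, so the bound covers every integer occurring in the Euler
  product.\<close>

lemma rankin_coefficient_le:
  fixes T d n :: real
  assumes "n > 0" "d \<ge> 0"
  shows "of_bool (n \<le> T) / sqrt n \<le> T powr (d / 2) * n powr (- ((1 + d) / 2))"
proof (cases "n \<le> T")
  case True
  have "1 / sqrt n = n powr (d / 2) * n powr (- ((1 + d) / 2))"
    using assms by (simp add: powr_half_sqrt[symmetric] powr_minus_divide[symmetric] add_divide_distrib flip: powr_add)
  also have "\<dots> \<le> T powr (d / 2) * n powr (- ((1 + d) / 2))"
    using True assms by (intro mult_right_mono powr_mono2) auto
  finally show ?thesis using True by simp
qed simp

section \<open>Moments of the partial sums\<close>

text \<open>Interpolation by the elementary inequality t^(k/K) <= 1 + t, applied to t = X^(2K) / A.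
  Integrating it costs a factor 2 and requires only an upper bound A for the even moment.\<close>

lemma (in prob_space) expectation_powr_le:
  fixes X :: "'a \<Rightarrow> real" and k A :: real and K :: nat
  assumes X: "\<And>\<omega>. X \<omega> \<ge> 0" and k: "0 < k" "k \<le> K"
    and int: "integrable M (\<lambda>\<omega>. X \<omega> ^ (2 * K))"
    and A: "A > 0" "expectation (\<lambda>\<omega>. X \<omega> ^ (2 * K)) \<le> A"
  shows "expectation (\<lambda>\<omega>. X \<omega> powr (2 * k)) \<le> 2 * A powr (k / K)"
proof -
  have le: "X \<omega> powr (2 * k) \<le> A powr (k / K) * (1 + X \<omega> ^ (2 * K) / A)" for \<omega>
  proof -
    define t where "t = X \<omega> ^ (2 * K) / A"
    have t: "t \<ge> 0" using X A by (simp add: t_def)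
    have "t powr (k / K) \<le> 1 + t"
    proof (cases "t \<le> 1")
      case True
      then have "t powr (k / K) \<le> 1" using t k by (intro powr_le1) auto
      then show ?thesis using t by linarith
    next
      case False
      then have "t powr (k / K) \<le> t powr 1" using k by (intro powr_mono) auto
      then show ?thesis using t by simp
    qed
    moreover have "X \<omega> powr (2 * k) = (X \<omega> ^ (2 * K)) powr (k / K)"
      using X[of \<omega>] k by (cases "X \<omega> = 0") (simp_all add: powr_powr flip: powr_realpow)
    moreover have "X \<omega> ^ (2 * K) = A * t" using A by (simp add: t_def)
    ultimately show ?thesis
      using A t unfolding t_def[symmetric] by (simp add: powr_mult mult_left_mono)
  qed
  have "expectation (\<lambda>\<omega>. X \<omega> powr (2 * k)) \<le> expectation (\<lambda>\<omega>. A powr (k / K) * (1 + X \<omega> ^ (2 * K) / A))"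
    using le int X A by (intro integral_mono') auto
  also have "\<dots> = A powr (k / K) * (1 + expectation (\<lambda>\<omega>. X \<omega> ^ (2 * K)) / A)"
    using int by (simp add: prob_space)
  also have "\<dots> \<le> A powr (k / K) * 2"
    using A by (intro mult_left_mono) auto
  finally show ?thesis by simp
qed

context steinhaus
begin

section \<open>Independence, orthogonality of monomials and monotonicity of even moments\<close>

lemma measurable_f:
  assumes "prime p"
  shows "f p \<in> borel_measurable M"
  using indep assms unfolding indep_vars_def by blast

text \<open>Functions of independent variables are independent. A bound on the unit circle alone
  suffices for integrability, since the uniform law lives there. The general value type serves both
  complex monomials and real powers of norms.\<close>

lemma
  fixes g :: "nat \<Rightarrow> complex \<Rightarrow> 'b :: {real_normed_field, banach, second_countable_topology}"
  assumes P: "finite P" "P \<subseteq> {p. prime p}"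
    and meas: "\<And>p. p \<in> P \<Longrightarrow> g p \<in> borel_measurable borel"
    and bound: "\<And>p z. p \<in> P \<Longrightarrow> norm z = 1 \<Longrightarrow> norm (g p z) \<le> B p"
  shows expectation_prod: "expectation (\<lambda>\<omega>. \<Prod>p\<in>P. g p (f p \<omega>)) = (\<Prod>p\<in>P. integral\<^sup>L uniform_circle (g p))"
    and integrable_prod: "integrable M (\<lambda>\<omega>. \<Prod>p\<in>P. g p (f p \<omega>))"
proof -
  have f_meas: "f p \<in> borel_measurable M" if "p \<in> P" for p
    using that P measurable_f by auto
  have int: "integrable M (\<lambda>\<omega>. g p (f p \<omega>))" if "p \<in> P" for p
  proof -
    have "integrable (distr M borel (f p)) (g p)"
      using that P integrable_uniform_circle[OF meas bound] by (subst uniform) auto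
    then show ?thesis
      by (rule integrable_distr[OF f_meas[OF that]])
  qed
  have ind: "indep_vars (\<lambda>_. borel) (\<lambda>p \<omega>. g p (f p \<omega>)) P"
    using indep_vars_compose2[OF indep_vars_subset[OF indep P(2)], of g "\<lambda>_. borel"] meas by simp
  show "integrable M (\<lambda>\<omega>. \<Prod>p\<in>P. g p (f p \<omega>))"
    by (rule indep_vars_integrable[OF P(1) ind int])
  have "expectation (\<lambda>\<omega>. g p (f p \<omega>)) = integral\<^sup>L uniform_circle (g p)" if "p \<in> P" for p
    using that P f_meas meas integral_distr[of "f p" M borel "g p"] uniform by auto
  then show "expectation (\<lambda>\<omega>. \<Prod>p\<in>P. g p (f p \<omega>)) = (\<Prod>p\<in>P. integral\<^sup>L uniform_circle (g p))"
    by (subst indep_vars_lebesgue_integral[OF P(1) ind int]) simp_all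
qed

text \<open>This is the value of the multiplicative extension at the integer with exponent vector e
  on P. With exponent vectors as indices, multiplying monomials means adding exponents.\<close>

definition monomial :: "nat set \<Rightarrow> (nat \<Rightarrow> nat) \<Rightarrow> 'w \<Rightarrow> complex" where
  "monomial P e \<omega> = (\<Prod>p\<in>P. f p \<omega> ^ e p)"

lemma
  assumes P: "finite P" "P \<subseteq> {p. prime p}"
  shows integrable_monomial_cnj: "integrable M (\<lambda>\<omega>. monomial P e \<omega> * cnj (monomial P e' \<omega>))" 
    and expectation_monomial_cnj: "expectation (\<lambda>\<omega>. monomial P e \<omega> * cnj (monomial P e' \<omega>)) =
           of_bool (\<forall>p\<in>P. e p = e' p)"
proof -
  define g where "g p z = z ^ e p * cnj z ^ e' p" for p z
  have eq: "monomial P e \<omega> * cnj (monomial P e' \<omega>) = (\<Prod>p\<in>P. g p (f p \<omega>))" for \<omega>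
    by (simp add: monomial_def g_def prod.distrib)
  have meas: "g p \<in> borel_measurable borel" for p
    unfolding g_def by (intro borel_measurable_continuous_onI continuous_intros)
  have bound: "norm (g p z) \<le> 1" if "norm z = 1" for p z
    using that by (simp add: g_def norm_mult norm_power)
  show "integrable M (\<lambda>\<omega>. monomial P e \<omega> * cnj (monomial P e' \<omega>))"
    unfolding eq by (rule integrable_prod[OF P meas bound])
  have "integral\<^sup>L uniform_circle (g p) = of_bool (e p = e' p)" for p
    using circle_moment[of "e p" "e' p"] by (simp add: g_def [abs_def])
  then show "expectation (\<lambda>\<omega>. monomial P e \<omega> * cnj (monomial P e' \<omega>)) =
           of_bool (\<forall>p\<in>P. e p = e' p)"
    unfolding eq by (subst expectation_prod[OF P meas bound]) (use P(1) in \<open>auto simp: prod_zero_iff\<close>)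
qed

text \<open>The diagonal condition compares exponent vectors, not indices, because distinct indices
  may carry the same monomial; this happens after expanding a K-th power into K-tuples.\<close>

lemma
  fixes a :: "'i \<Rightarrow> real" and e :: "'i \<Rightarrow> nat \<Rightarrow> nat"
  assumes P: "finite P" "P \<subseteq> {p. prime p}"
  shows integrable_monomial_sum: "integrable M (\<lambda>\<omega>. (norm (\<Sum>i\<in>I. of_real (a i) * monomial P (e i) \<omega>))\<^sup>2)"
    and expectation_monomial_sum: "expectation (\<lambda>\<omega>. (norm (\<Sum>i\<in>I. of_real (a i) * monomial P (e i) \<omega>))\<^sup>2) =
           (\<Sum>i\<in>I. \<Sum>j\<in>I. a i * a j * of_bool (\<forall>p\<in>P. e i p = e j p))"
proof -
  let ?h = "\<lambda>i j \<omega>. of_real (a i * a j) * (monomial P (e i) \<omega> * cnj (monomial P (e j) \<omega>))"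
  have eq: "complex_of_real ((norm (\<Sum>i\<in>I. of_real (a i) * monomial P (e i) \<omega>))\<^sup>2) =
      (\<Sum>i\<in>I. \<Sum>j\<in>I. ?h i j \<omega>)" for \<omega>
    by (simp add: complex_norm_square sum_product mult_ac del: of_real_power)
  have int: "integrable M (\<lambda>\<omega>. ?h i j \<omega>)" for i j
    using integrable_monomial_cnj[OF P] by (intro integrable_mult_right)
  have "integrable M (\<lambda>\<omega>. complex_of_real ((norm (\<Sum>i\<in>I. of_real (a i) * monomial P (e i) \<omega>))\<^sup>2))"
    unfolding eq by (intro Bochner_Integration.integrable_sum int)
  then show "integrable M (\<lambda>\<omega>. (norm (\<Sum>i\<in>I. of_real (a i) * monomial P (e i) \<omega>))\<^sup>2)"
    using integrable_Re by fastforce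
  have "complex_of_real (expectation (\<lambda>\<omega>. (norm (\<Sum>i\<in>I. of_real (a i) * monomial P (e i) \<omega>))\<^sup>2)) =
     expectation (\<lambda>\<omega>. \<Sum>i\<in>I. \<Sum>j\<in>I. ?h i j \<omega>)"
    unfolding eq[symmetric] by (rule integral_complex_of_real[symmetric])
  also have "\<dots> = (\<Sum>i\<in>I. \<Sum>j\<in>I. expectation (?h i j))"
    using int by (simp add: Bochner_Integration.integral_sum Bochner_Integration.integrable_sum del: of_real_mult)
  also have "\<dots> = (\<Sum>i\<in>I. \<Sum>j\<in>I. of_real (a i * a j) * of_bool (\<forall>p\<in>P. e i p = e j p))"
    by (simp add: expectation_monomial_cnj[OF P] del: of_real_mult)
  also have "\<dots> = of_real (\<Sum>i\<in>I. \<Sum>j\<in>I. a i * a j * of_bool (\<forall>p\<in>P. e i p = e j p))"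
    unfolding of_real_sum by (intro sum.cong refl) simp
  finally show "expectation (\<lambda>\<omega>. (norm (\<Sum>i\<in>I. of_real (a i) * monomial P (e i) \<omega>))\<^sup>2) =
           (\<Sum>i\<in>I. \<Sum>j\<in>I. a i * a j * of_bool (\<forall>p\<in>P. e i p = e j p))"
    using of_real_eq_iff by blast
qed

lemma monomial_sum_power:
  fixes a :: "'i \<Rightarrow> real"
  assumes "finite I"
  shows "(\<Sum>i\<in>I. of_real (a i) * monomial P (e i) \<omega>) ^ K =
    (\<Sum>g\<in>PiE {..<K} (\<lambda>_. I). of_real (\<Prod>k<K. a (g k)) * monomial P (\<lambda>p. \<Sum>k<K. e (g k) p) \<omega>)"
proof -
  have "(\<Sum>i\<in>I. of_real (a i) * monomial P (e i) \<omega>) ^ K =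
      (\<Prod>k<K. \<Sum>i\<in>I. of_real (a i) * monomial P (e i) \<omega>)"
    by simp
  also have "\<dots> = (\<Sum>g\<in>PiE {..<K} (\<lambda>_. I). \<Prod>k<K. of_real (a (g k)) * monomial P (e (g k)) \<omega>)"
    using assms by (subst prod_sum_PiE) auto
  also have "\<dots> = (\<Sum>g\<in>PiE {..<K} (\<lambda>_. I). of_real (\<Prod>k<K. a (g k)) * monomial P (\<lambda>p. \<Sum>k<K. e (g k) p) \<omega>)"
    unfolding monomial_def power_sum by (subst prod.swap) (simp add: prod.distrib)
  finally show ?thesis .
qed

text \<open>Since |F|^(2K) = |F^K|^2 and the coefficients of F^K are products of those of F, the
  moment is a double sum of coefficient products with weights 0 or 1, hence monotone in nonnegative
  coefficients.\<close>

lemma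
  fixes a b :: "'i \<Rightarrow> real"
  assumes P: "finite P" "P \<subseteq> {p. prime p}" and I: "finite I"
    and ab: "\<And>i. i \<in> I \<Longrightarrow> 0 \<le> a i" "\<And>i. i \<in> I \<Longrightarrow> a i \<le> b i"
  shows integrable_monomial_power:
      "integrable M (\<lambda>\<omega>. norm (\<Sum>i\<in>I. of_real (a i) * monomial P (e i) \<omega>) ^ (2 * K))"
    and expectation_monomial_power_mono:
      "expectation (\<lambda>\<omega>. norm (\<Sum>i\<in>I. of_real (a i) * monomial P (e i) \<omega>) ^ (2 * K))
         \<le> expectation (\<lambda>\<omega>. norm (\<Sum>i\<in>I. of_real (b i) * monomial P (e i) \<omega>) ^ (2 * K))"
proof -
  have eq: "norm (\<Sum>i\<in>I. of_real (c i) * monomial P (e i) \<omega>) ^ (2 * K) =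
      (norm (\<Sum>g\<in>PiE {..<K} (\<lambda>_. I). of_real (\<Prod>k<K. c (g k)) * monomial P (\<lambda>p. \<Sum>k<K. e (g k) p) \<omega>))\<^sup>2" 
    for c :: "'i \<Rightarrow> real" and \<omega>
    unfolding monomial_sum_power[OF I, symmetric] by (simp add: norm_power power_mult mult.commute)
  show "integrable M (\<lambda>\<omega>. norm (\<Sum>i\<in>I. of_real (a i) * monomial P (e i) \<omega>) ^ (2 * K))"
    unfolding eq by (rule integrable_monomial_sum[OF P])
  have "0 \<le> (\<Prod>k<K. a (g k)) \<and> (\<Prod>k<K. a (g k)) \<le> (\<Prod>k<K. b (g k))" if "g \<in> PiE {..<K} (\<lambda>_. I)" for g
    using that ab by (auto intro!: prod_nonneg prod_mono simp: PiE_iff)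
  then show "expectation (\<lambda>\<omega>. norm (\<Sum>i\<in>I. of_real (a i) * monomial P (e i) \<omega>) ^ (2 * K))
         \<le> expectation (\<lambda>\<omega>. norm (\<Sum>i\<in>I. of_real (b i) * monomial P (e i) \<omega>) ^ (2 * K))"
    unfolding eq expectation_monomial_sum[OF P]
    by (intro sum_mono mult_right_mono mult_mono) (auto intro: order_trans)
qed

section \<open>The partial sum as a polynomial in the f(p), compared with an Euler product\<close>

text \<open>The sum is taken over a full box of exponent vectors, with coefficient 0 when the
  integer exceeds T. The box is the index set of the expanded Euler product, so the two can be
  compared coefficient by coefficient.\<close>

lemma partial_sum_eq_monomial_sum:
  fixes T :: real
  defines "P \<equiv> {p. prime p \<and> real p \<le> T}"
  defines "I \<equiv> PiE P (\<lambda>_. {..nat \<lfloor>T\<rfloor>})"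
  shows "partial_sum f T \<omega> = (\<Sum>e\<in>I. of_real (of_bool (real (\<Prod>p\<in>P. p ^ e p) \<le> T) / sqrt (real (\<Prod>p\<in>P. p ^ e p))) * monomial P e \<omega>)"
proof -
  define N where "N e = (\<Prod>p\<in>P. p ^ e p)" for e :: "nat \<Rightarrow> nat"
  \<comment> \<open>\<open>restrict\<close> puts the exponent vector into the extensional function
    space, so that \<open>E\<close> and \<open>N\<close> are mutually inverse.\<close>
  define E where "E n = restrict (\<lambda>p. multiplicity p n) P" for n :: nat
  have fin: "finite P"
    by (rule finite_subset[of _ "{..nat \<lfloor>T\<rfloor>}"]) (auto simp: P_def le_nat_floor)
  have N_pos: "N e > 0" for e
    unfolding N_def by (intro prod_pos) (auto simp: P_def prime_gt_0_nat)
  have finI: "finite I"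
    unfolding I_def using fin by (intro finite_PiE) auto
  have factors: "prime_factors n \<subseteq> P" if "1 \<le> n" "real n \<le> T" for n
  proof
    fix p assume "p \<in> prime_factors n"
    then have "prime p" "p \<le> n" using that by (auto intro: dvd_imp_le)
    then show "p \<in> P" using that by (simp add: P_def)
  qed
  have mult_0: "multiplicity p n = 0" if "p \<in> P - prime_factors n" "1 \<le> n" for p n
    using that by (intro not_dvd_imp_multiplicity_0) (auto simp: P_def in_prime_factors_iff)
  have N_E: "N (E n) = n" if "1 \<le> n" "real n \<le> T" for n
  proof -
    have "N (E n) = (\<Prod>p\<in>prime_factors n. p ^ multiplicity p n)"
      unfolding N_def E_def
      by (rule prod.mono_neutral_cong_right[OF fin factors[OF that]]) 
         (use mult_0 that(1) factors[OF that] in auto)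
    also have "\<dots> = n"
      using that by (intro prime_factorization_nat[symmetric]) simp
    finally show ?thesis .
  qed
  have E_N: "E (N e) = e" if "e \<in> I" for e
  proof
    fix p
    show "E (N e) p = e p"
    proof (cases "p \<in> P")
      case True
      have "multiplicity p (\<Prod>q\<in>P. q ^ e q) = (if p \<in> P then e p else 0)"
        by (rule multiplicity_prod_prime_powers) (use fin True in \<open>auto simp: P_def\<close>)
      then show ?thesis
        unfolding E_def N_def using True by (simp only: restrict_apply' if_True)
    next
      case False
      then show ?thesis using that by (auto simp: E_def I_def PiE_def extensional_def)
    qed
  qed
  have E_in: "E n \<in> I" if "1 \<le> n" "real n \<le> T" for n
  proof -
    have "multiplicity p n \<le> nat \<lfloor>T\<rfloor>" if "p \<in> P" for p
    proof -
      have "multiplicity p n \<le> n"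
        using that \<open>1 \<le> n\<close> by (intro multiplicity_le_self) (auto simp: P_def)
      also have "n \<le> nat \<lfloor>T\<rfloor>"
        using \<open>real n \<le> T\<close> by (rule le_nat_floor)
      finally show ?thesis .
    qed
    then show ?thesis by (auto simp: E_def I_def)
  qed
  have mult: "mult_ext f n \<omega> = monomial P (E n) \<omega>" if "1 \<le> n" "real n \<le> T" for n
    unfolding mult_ext_def monomial_def E_def
    by (rule prod.mono_neutral_cong_left[OF fin factors[OF that]])
       (use mult_0 that(1) factors[OF that] in auto)
  \<comment> \<open>Unique factorization matches the integers up to T with the vectors of the box
    whose integer is at most T.\<close>
  have "partial_sum f T \<omega> = (\<Sum>e | e \<in> I \<and> real (N e) \<le> T. monomial P e \<omega> / complex_of_real (sqrt (real (N e))))"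
    unfolding partial_sum_def
    by (rule sum.reindex_bij_witness[where i = N and j = E])
       (simp_all add: N_E E_N E_in mult N_pos Suc_le_eq)
  also have "\<dots> = (\<Sum>e\<in>I. of_real (of_bool (real (N e) \<le> T) / sqrt (real (N e))) * monomial P e \<omega>)"
    by (rule sum.mono_neutral_cong_left) (use finI in auto)
  finally show ?thesis unfolding N_def .
qed

text \<open>Truncating every local series at the same J makes the expansion run over exactly the box
  of exponent vectors.\<close>

lemma euler_product_expand:
  assumes "finite P"
  shows "(\<Prod>p\<in>P. \<Sum>j\<le>J. (of_real (real p powr (- s)) * f p \<omega>) ^ j) =
    (\<Sum>e\<in>PiE P (\<lambda>_. {..J}). of_real (real (\<Prod>p\<in>P. p ^ e p) powr (- s)) * monomial P e \<omega>)"
proof -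
  have "real (\<Prod>p\<in>P. p ^ e p) powr (- s) = (\<Prod>p\<in>P. (real p powr (- s)) ^ e p)" for e :: "nat \<Rightarrow> nat"
    by (simp add: prod_powr_distrib powr_power_swap)
  then show ?thesis
    using assms by (simp add: prod_sum_PiE power_mult_distrib prod.distrib monomial_def)
qed

lemma
  fixes T d :: real and K :: nat
  assumes d: "d \<ge> 0" and T: "T > 0"
  defines "P \<equiv> {p. prime p \<and> real p \<le> T}"
  shows integrable_partial_sum_power: "integrable M (\<lambda>\<omega>. norm (partial_sum f T \<omega>) ^ (2 * K))"
    and expectation_partial_sum_le_prod:
      "expectation (\<lambda>\<omega>. norm (partial_sum f T \<omega>) ^ (2 * K)) \<le> T powr (d * K) *
        (\<Prod>p\<in>P. integral\<^sup>L uniform_circle 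
           (\<lambda>z. norm (\<Sum>j\<le>nat \<lfloor>T\<rfloor>. (of_real (real p powr (- ((1 + d) / 2))) * z) ^ j) ^ (2 * K)))"
proof -
  define J where "J = nat \<lfloor>T\<rfloor>"
  define s where "s = (1 + d) / 2"
  define I where "I = PiE P (\<lambda>_. {..J})"
  define N where "N e = real (\<Prod>p\<in>P. p ^ e p)" for e :: "nat \<Rightarrow> nat"
  define a where "a e = of_bool (N e \<le> T) / sqrt (N e)" for e
  define b where "b e = T powr (d / 2) * N e powr (- s)" for e
  define g where "g p z = norm (\<Sum>j\<le>J. (of_real (real p powr (- s)) * z) ^ j) ^ (2 * K)" for p :: nat and z :: complex
  have fin: "finite P"
    unfolding P_def by (rule finite_subset[of _ "{..nat \<lfloor>T\<rfloor>}"]) (auto simp: le_nat_floor)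
  have primes: "P \<subseteq> {p. prime p}" by (auto simp: P_def)
  have finI: "finite I"
    unfolding I_def using fin by (intro finite_PiE) auto
  have N_pos: "N e > 0" for e
    unfolding N_def of_nat_0_less_iff by (intro prod_pos) (auto simp: P_def prime_gt_0_nat)
  have psum: "partial_sum f T = (\<lambda>\<omega>. \<Sum>e\<in>I. of_real (a e) * monomial P e \<omega>)"
    using partial_sum_eq_monomial_sum[of T] unfolding a_def N_def I_def J_def P_def by blast
  have ab: "0 \<le> a e" "a e \<le> b e" for e
    using rankin_coefficient_le[OF N_pos d] N_pos[of e] by (auto simp: a_def b_def s_def)
  show "integrable M (\<lambda>\<omega>. norm (partial_sum f T \<omega>) ^ (2 * K))"
    unfolding psum by (rule integrable_monomial_power[OF fin primes finI ab])
  have b_sum: "norm (\<Sum>e\<in>I. of_real (b e) * monomial P e \<omega>) ^ (2 * K) = T powr (d * K) * (\<Prod>p\<in>P. g p (f p \<omega>))" for \<omega>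
  proof -
    have "(\<Sum>e\<in>I. of_real (b e) * monomial P e \<omega>) = 
       of_real (T powr (d / 2)) * (\<Prod>p\<in>P. \<Sum>j\<le>J. (of_real (real p powr (- s)) * f p \<omega>) ^ j)"
      unfolding euler_product_expand[OF fin] b_def I_def N_def sum_distrib_left by (simp add: mult.assoc)
    moreover have "(T powr (d / 2)) ^ (2 * K) = T powr (d * K)"
      using T by (simp add: powr_power mult_ac)
    ultimately show ?thesis
      using T by (simp only: g_def norm_mult power_mult_distrib prod_power_distrib prod_norm[symmetric]) simp
  qed
  have meas: "g p \<in> borel_measurable borel" for p
    unfolding g_def by (intro borel_measurable_continuous_onI continuous_intros)
  have bound: "norm (g p z) \<le> (\<Sum>j\<le>J. (real p powr (- s)) ^ j) ^ (2 * K)" if "norm z = 1" for p z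
    using that unfolding g_def by (auto intro!: power_mono sum_norm_le simp: norm_mult norm_power)
  have "expectation (\<lambda>\<omega>. norm (partial_sum f T \<omega>) ^ (2 * K)) 
      \<le> expectation (\<lambda>\<omega>. norm (\<Sum>e\<in>I. of_real (b e) * monomial P e \<omega>) ^ (2 * K))"
    unfolding psum by (rule expectation_monomial_power_mono[OF fin primes finI ab])
  also have "\<dots> = T powr (d * K) * expectation (\<lambda>\<omega>. \<Prod>p\<in>P. g p (f p \<omega>))"
    unfolding b_sum by (rule integral_mult_right_zero)
  also have "\<dots> = T powr (d * K) * (\<Prod>p\<in>P. integral\<^sup>L uniform_circle (g p))"
    using expectation_prod[OF fin primes meas bound] by simp
  finally show "expectation (\<lambda>\<omega>. norm (partial_sum f T \<omega>) ^ (2 * K)) \<le> T powr (d * K) *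
        (\<Prod>p\<in>P. integral\<^sup>L uniform_circle 
           (\<lambda>z. norm (\<Sum>j\<le>nat \<lfloor>T\<rfloor>. (of_real (real p powr (- ((1 + d) / 2))) * z) ^ j) ^ (2 * K)))"
    unfolding g_def J_def s_def .
qed

section \<open>Choice of d and passage to real k\<close>

lemma expectation_partial_sum_even_le:
  fixes T :: real and K :: nat
  assumes T: "T > 1" and K: "K \<ge> 1"
  shows "expectation (\<lambda>\<omega>. norm (partial_sum f T \<omega>) ^ (2 * K)) \<le> exp (34 * (real K)\<^sup>2) * (1 + ln T / K) ^ K\<^sup>2"
proof -
  \<comment> \<open>This d makes the Rankin loss T^(dK) equal to exp(K^2), the order of the other
    errors, and 1 + 1/d equal to 1 + ln T / K.\<close>
  define d where "d = K / ln T"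
  define P where "P = {p. prime p \<and> real p \<le> T}"
  define B where "B p = (if p \<le> 4 * K\<^sup>2 then 8 * real K * (1 / sqrt (real p)) else 2 * real K ^ 4 * (1 / (real p)\<^sup>2))" for p
  have d: "d > 0" using T K by (simp add: d_def)
  have fin: "finite P"
    unfolding P_def by (rule finite_subset[of _ "{..nat \<lfloor>T\<rfloor>}"]) (auto simp: le_nat_floor)
  have "expectation (\<lambda>\<omega>. norm (partial_sum f T \<omega>) ^ (2 * K)) \<le> T powr (d * K) *
        (\<Prod>p\<in>P. integral\<^sup>L uniform_circle 
           (\<lambda>z. norm (\<Sum>j\<le>nat \<lfloor>T\<rfloor>. (of_real (real p powr (- ((1 + d) / 2))) * z) ^ j) ^ (2 * K)))"
    unfolding P_def using T d by (intro expectation_partial_sum_le_prod) auto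
  also have "\<dots> \<le> T powr (d * K) * (\<Prod>p\<in>P. (1 + real p powr (- 1 - d)) ^ K\<^sup>2 * exp (B p))"
  proof (intro mult_left_mono prod_mono conjI)
    fix p assume "p \<in> P"
    then show "integral\<^sup>L uniform_circle 
           (\<lambda>z. norm (\<Sum>j\<le>nat \<lfloor>T\<rfloor>. (of_real (real p powr (- ((1 + d) / 2))) * z) ^ j) ^ (2 * K))
        \<le> (1 + real p powr (- 1 - d)) ^ K\<^sup>2 * exp (B p)"
      unfolding B_def using d by (intro circle_geometric_moment_le_euler_factor) (auto simp: P_def)
  qed auto
  also have "\<dots> = T powr (d * K) * ((\<Prod>p\<in>P. 1 + real p powr (- 1 - d)) ^ K\<^sup>2 * exp (\<Sum>p\<in>P. B p))"
    by (simp add: prod.distrib prod_power_distrib exp_sum fin)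
  also have "\<dots> \<le> T powr (d * K) * ((1 + 1 / d) ^ K\<^sup>2 * exp (33 * (real K)\<^sup>2))"
  proof (intro mult_left_mono mult_mono power_mono)
    show "(\<Prod>p\<in>P. 1 + real p powr (- 1 - d)) \<le> 1 + 1 / d"
      using d fin by (intro prod_primes_powr_le) (auto simp: P_def)
    have "(\<Sum>p\<in>P. B p) \<le> 33 * (real K)\<^sup>2"
      unfolding B_def using K fin by (intro sum_error_exponents_le) (auto simp: P_def dest: prime_ge_1_nat)
    then show "exp (\<Sum>p\<in>P. B p) \<le> exp (33 * (real K)\<^sup>2)" by simp
  qed (use d in \<open>auto intro!: prod_nonneg\<close>)
  also have "T powr (d * K) = exp ((real K)\<^sup>2)"
    using T by (simp add: powr_def d_def power2_eq_square)
  also have "exp ((real K)\<^sup>2) * ((1 + 1 / d) ^ K\<^sup>2 * exp (33 * (real K)\<^sup>2)) 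
      = exp (34 * (real K)\<^sup>2) * (1 + ln T / K) ^ K\<^sup>2"
    by (simp add: d_def flip: exp_add)
  finally show ?thesis .
qed

text \<open>Rounding k up to K raises the exponent of 1 + L/k from k^2 to at most k^2 + k; the
  hypothesis \<open>kT\<close> pays for the surplus. The constant is 71 = 68 + 1 + 1 + 1: the even
  moment, the factor 2, the surplus power, and the replacement of 1 + L/k by a maximum.\<close>

lemma expectation_partial_sum_powr_le:
  fixes T k :: real
  assumes T: "T > 1" and k: "k \<ge> 1" and kT: "1 + ln T / k \<le> exp k"
  shows "expectation (\<lambda>\<omega>. norm (partial_sum f T \<omega>) powr (2 * k))
     \<le> exp (71 * k\<^sup>2) * max 1 ((ln T) powr (k\<^sup>2) * exp (- (k\<^sup>2) * ln k))"
proof -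
  define K where "K = nat \<lceil>k\<rceil>"
  define L where "L = ln T"
  have L: "L > 0" using T by (simp add: L_def)
  have K: "K \<ge> 1" "k \<le> K" "K \<le> k + 1"
    unfolding K_def using k by linarith+
  define A where "A = exp (34 * (real K)\<^sup>2) * (1 + L / K) ^ K\<^sup>2"
  have pos: "1 + L / K > 0" "1 + L / k > 0" "1 + L / k \<ge> 1" using L K k by (auto intro!: add_pos_pos)
  have A: "A > 0" unfolding A_def using pos by simp
  have "k \<le> k\<^sup>2" using k by (simp add: power2_eq_square)
  have "1 \<le> k\<^sup>2" using k by simp
  have "expectation (\<lambda>\<omega>. norm (partial_sum f T \<omega>) powr (2 * k)) \<le> 2 * A powr (k / K)"
    using K k T A expectation_partial_sum_even_le[OF T K(1)] integrable_partial_sum_power[of 0 T K]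
    by (intro expectation_powr_le) (auto simp: A_def L_def)
  also have "A powr (k / K) = exp (34 * (K * k)) * (1 + L / K) powr (K * k)"
    using pos K by (simp add: A_def powr_mult powr_powr power2_eq_square exp_powr_real flip: powr_realpow)
  also have "2 * (exp (34 * (K * k)) * (1 + L / K) powr (K * k)) \<le> 
      exp (k\<^sup>2) * (exp (68 * k\<^sup>2) * (1 + L / k) powr (k + k\<^sup>2))"
  proof (intro mult_mono)
    have "2 \<le> 1 + k\<^sup>2" using \<open>1 \<le> k\<^sup>2\<close> by simp
    then show "2 \<le> exp (k\<^sup>2)" using exp_ge_add_one_self[of "k\<^sup>2"] by linarith
    have "K * k \<le> (k + 1) * k" using K k by (intro mult_right_mono) auto
    then have Kk: "K * k \<le> k + k\<^sup>2" by (simp add: power2_eq_square algebra_simps)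
    then have "34 * (K * k) \<le> 68 * k\<^sup>2" using \<open>k \<le> k\<^sup>2\<close> by linarith
    then show "exp (34 * (K * k)) \<le> exp (68 * k\<^sup>2)" by (simp only: exp_le_cancel_iff)
    \<comment> \<open>The base grows when K is replaced by k; since it is then at least 1, the
      exponent may be enlarged too.\<close>
    have "(1 + L / K) powr (K * k) \<le> (1 + L / k) powr (K * k)"
      using K k L pos by (intro powr_mono2) (auto simp: field_simps)
    also have "\<dots> \<le> (1 + L / k) powr (k + k\<^sup>2)"
      using Kk pos by (intro powr_mono) auto
    finally show "(1 + L / K) powr (K * k) \<le> (1 + L / k) powr (k + k\<^sup>2)" .
  qed auto
  also have "\<dots> = exp (69 * k\<^sup>2) * ((1 + L / k) powr k * (1 + L / k) powr k\<^sup>2)"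
    by (simp add: powr_add flip: exp_add)
  also have "\<dots> \<le> exp (69 * k\<^sup>2) * (exp (k\<^sup>2) * (exp (k\<^sup>2) * max 1 ((L / k) powr k\<^sup>2)))"
  proof (intro mult_left_mono mult_mono)
    have "(1 + L / k) powr k \<le> exp k powr k"
      using kT pos k by (intro powr_mono2) (auto simp: L_def)
    then show "(1 + L / k) powr k \<le> exp (k\<^sup>2)"
      by (simp add: exp_powr_real power2_eq_square)
    \<comment> \<open>The maximum absorbs the summand 1: 1 + x <= 2 max(1, x), and 2 <= e.\<close>
    have "(1 + L / k) powr k\<^sup>2 \<le> (exp 1 * max 1 (L / k)) powr k\<^sup>2"
    proof (intro powr_mono2)
      have "1 + L / k \<le> 2 * max 1 (L / k)" by linarith
      also have "\<dots> \<le> exp 1 * max 1 (L / k)"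
        using exp_ge_add_one_self[of "1::real"] by (intro mult_right_mono) auto
      finally show "1 + L / k \<le> exp 1 * max 1 (L / k)" .
    qed (use pos in auto)
    also have "\<dots> = exp (k\<^sup>2) * max 1 (L / k) powr k\<^sup>2"
      by (simp add: powr_mult exp_powr_real)
    also have "max 1 (L / k) powr k\<^sup>2 \<le> max 1 ((L / k) powr k\<^sup>2)"
      by (simp add: max_def)
    finally show "(1 + L / k) powr k\<^sup>2 \<le> exp (k\<^sup>2) * max 1 ((L / k) powr k\<^sup>2)" by simp
  qed auto
  also have "\<dots> = exp (71 * k\<^sup>2) * max 1 ((L / k) powr k\<^sup>2)"
    by (simp flip: mult.assoc exp_add)
  also have "(L / k) powr k\<^sup>2 = L powr k\<^sup>2 * exp (- (k\<^sup>2) * ln k)"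
    using L k by (simp add: powr_def ln_div right_diff_distrib flip: exp_add)
  finally show ?thesis by (simp add: L_def)
qed

end

text \<open>With k0 = c ln T / ln ln T the left side of the last condition is 1 + ln ln T / c, far
  smaller than exp(k0).\<close>

lemma eventually_lower_range:
  fixes c :: real
  assumes "c > 0"
  shows "\<forall>\<^sub>F T in at_top. T > 1 \<and> c * ln T / ln (ln T) \<ge> 1 \<and> 
     1 + ln T / (c * ln T / ln (ln T)) \<le> exp (c * ln T / ln (ln T))"
proof (intro eventually_conj)
  show "\<forall>\<^sub>F T in at_top. T > (1::real)" by (rule eventually_gt_at_top)
  show "\<forall>\<^sub>F T in at_top. c * ln T / ln (ln T) \<ge> 1" using assms by real_asymp
  show "\<forall>\<^sub>F T in at_top. 1 + ln T / (c * ln T / ln (ln T)) \<le> exp (c * ln T / ln (ln T))"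
    using assms by real_asymp
qed

theorem proposition4:
  "\<exists>C::real. C > 0 \<and> (\<forall>c::real. c > 0 \<longrightarrow>
     (\<forall>\<^sub>F T::real in at_top. \<forall>k::real. k \<ge> c * ln T / ln (ln T) \<longrightarrow>
        (\<forall>(M :: 'w measure) f. steinhaus M f \<longrightarrow>
           prob_space.expectation M (\<lambda>\<omega>. norm (partial_sum f T \<omega>) powr (2 * k))
             \<le> exp (C * k\<^sup>2) * max 1 ((ln T) powr (k\<^sup>2) * exp (- (k\<^sup>2) * ln k)))))"
proof (intro exI[of _ 71] conjI allI impI)
  \<comment> \<open>The constant 71 is fixed before c; only the threshold for T depends on
    c.\<close>
  fix c :: real assume c: "c > 0"
  show "\<forall>\<^sub>F T::real in at_top. \<forall>k::real. k \<ge> c * ln T / ln (ln T) \<longrightarrow>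
        (\<forall>(M :: 'w measure) f. steinhaus M f \<longrightarrow>
           prob_space.expectation M (\<lambda>\<omega>. norm (partial_sum f T \<omega>) powr (2 * k))
             \<le> exp (71 * k\<^sup>2) * max 1 ((ln T) powr (k\<^sup>2) * exp (- (k\<^sup>2) * ln k)))"
    using eventually_lower_range[OF c]
  proof eventually_elim
    case (elim T)
    define k0 where "k0 = c * ln T / ln (ln T)"
    have k0: "T > 1" "k0 \<ge> 1" "1 + ln T / k0 \<le> exp k0"
      using elim[folded k0_def] by blast+
    show ?case
      unfolding k0_def[symmetric]
    proof (intro allI impI)
      fix k and M :: "'w measure" and f assume k: "k0 \<le> k" and "steinhaus M f"
      then interpret steinhaus M f by simp
      \<comment> \<open>The condition at k0 passes to all k >= k0, as its left side decreases and
        its right side increases in k.\<close>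
      have "1 + ln T / k \<le> 1 + ln T / k0"
        using k k0 by (intro add_left_mono divide_left_mono) auto
      also have "\<dots> \<le> exp k" using k0 k by (smt (verit) exp_le_cancel_iff)
      finally show "expectation (\<lambda>\<omega>. norm (partial_sum f T \<omega>) powr (2 * k))
             \<le> exp (71 * k\<^sup>2) * max 1 ((ln T) powr (k\<^sup>2) * exp (- (k\<^sup>2) * ln k))"
        using k k0 by (intro expectation_partial_sum_powr_le) auto
    qed
  qed
qed simp

end
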